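(* Let $(X,d)$ be a metric space equipped with a Borel regular measure $\mu$ which is doubling with constant $C_\mu$, and let $E\subset X$. Then $$AM(\Gamma(E))\le C_\mu\, co\mathcal H^1(E),$$ and for every $p>1$, $co\mathcal H^p(E)<\infty$ implies $M_p(\Gamma(E))=0$.
   Context: $B(x,r)$ denotes the open ball. $\mu$ is doubling with constant $C_\mu$ if $\mu(B(x,2r))\le C_\mu\,\mu(B(x,r))$ and $0<\mu(B(x,r))<\infty$ for all open balls $B(x,r)$ in $X$. A curve is a continuous map $\gamma:[a,b]\to X$; a path is a curve of finite and non-zero total length, parametrized by arclength on $[0,\ell]$. $\Gamma(E)$ is the family of all paths in $X$ which meet $E$ (i.e. whose image intersects $E$). Let $\Gamma$ be a family of paths in $X$ and $p\ge 1$. A non-negative Borel function $\rho$ is admissible for $\Gamma$ if $\int_\gamma\rho\,ds\ge 1$ for every $\gamma\in\Gamma$; $M_p(\Gamma)=\inf\int_X\rho^p\,d\mu$ over all admissible $\rho$. A sequence $(\rho_i)$ of non-negative Borel functions is $AM$-admissible for $\Gamma$ if $\liminf_{i\to\infty}\int_\gamma\rho_i\,ds\ge1$ for every $\gamma\in\Gamma$; $AM(\Gamma)=\inf_{(\rho_i)}\{\liminf_{i\to\infty}\int_X\rho_i\,d\mu\}$ over all $AM$-admissible sequences. For $p\ge1$ the Hausdorff measure of codimension $p$ is $co\mathcal H^p(E)=\sup_{\delta>0}co\mathcal H^p_\delta(E)$, where $$co\mathcal H^p_\delta(E)=\inf\Bigl\{\sum_{j=1}^\infty\frac{\mu(B(x_j,r_j))}{r_j^p}:\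 E\subset\bigcup_{j=1}^\infty B(x_j,r_j),\ \sup_j r_j<\delta\Bigr\}.$$ *)

theory Defs
  imports "HOL-Analysis.Analysis"
begin

text \<open>
  The metric space \<open>X\<close> is the whole type. A measure on a set algebra containing the Borel sets stands
  for the outer measure \<open>outer_measure_of M\<close> that it induces; Borel regularity is a condition
  on that outer measure, for arbitrary subsets of the space.
\<close>

definition borel_regular :: "'a::metric_space measure \<Rightarrow> bool" where
  "borel_regular M \<longleftrightarrow>
     space M = UNIV \<and> sets borel \<subseteq> sets M \<and>
     (\<forall>A. \<exists>B\<in>sets borel. A \<subseteq> B \<and> emeasure M B = outer_measure_of M A)"

definition doubling_measure :: "'a::metric_space measure \<Rightarrow> real \<Rightarrow> bool" where
  "doubling_measure M C \<longleftrightarrow>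
     (\<forall>x r. 0 < r \<longrightarrow>
        0 < emeasure M (ball x r) \<and> emeasure M (ball x r) < \<infinity> \<and>
        emeasure M (ball x (2 * r)) \<le> ennreal C * emeasure M (ball x r))"

definition curve_length :: "(real \<Rightarrow> 'a::metric_space) \<Rightarrow> real \<Rightarrow> real \<Rightarrow> ennreal" where
  "curve_length \<gamma> a b =
     (SUP (n, t) \<in> {(n, t). t 0 = a \<and> t n = b \<and> mono_on {..n} t}.
        ennreal (\<Sum>i<n. dist (\<gamma> (t i)) (\<gamma> (t (Suc i)))))"

text \<open>
  A path is a pair \<open>(l, \<gamma>)\<close> of its length and its arclength parametrization on \<open>{0..l}\<close>;
  the values of \<open>\<gamma>\<close> outside \<open>{0..l}\<close> are irrelevant.
\<close>

type_synonym 'a arc_path = "real \<times> (real \<Rightarrow> 'a)"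

definition is_arc_path :: "'a::metric_space arc_path \<Rightarrow> bool" where
  "is_arc_path = (\<lambda>(l, \<gamma>). 0 < l \<and> continuous_on {0..l} \<gamma> \<and>
     (\<forall>s\<in>{0..l}. curve_length \<gamma> 0 s = ennreal s))"

definition paths_meeting :: "'a::metric_space set \<Rightarrow> 'a arc_path set" where
  "paths_meeting E = {(l, \<gamma>). is_arc_path (l, \<gamma>) \<and> \<gamma> ` {0..l} \<inter> E \<noteq> {}}"

definition path_integral :: "'a arc_path \<Rightarrow> ('a \<Rightarrow> ennreal) \<Rightarrow> ennreal" where
  "path_integral = (\<lambda>(l, \<gamma>) \<rho>. \<integral>\<^sup>+ s\<in>{0..l}. \<rho> (\<gamma> s) \<partial>lborel)"

text \<open>Powers with a positive real exponent, where \<open>\<infinity>\<close> to the power \<open>p\<close> is \<open>\<infinity>\<close>.\<close>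

definition ennreal_powr :: "ennreal \<Rightarrow> real \<Rightarrow> ennreal" where
  "ennreal_powr x p = (if x = \<infinity> then \<infinity> else ennreal (enn2real x powr p))"

definition admissible :: "'a::metric_space arc_path set \<Rightarrow> ('a \<Rightarrow> ennreal) \<Rightarrow> bool" where
  "admissible \<Gamma> \<rho> \<longleftrightarrow>
     \<rho> \<in> borel_measurable borel \<and> (\<forall>\<gamma>\<in>\<Gamma>. 1 \<le> path_integral \<gamma> \<rho>)"

definition modulus :: "'a::metric_space measure \<Rightarrow> real \<Rightarrow> 'a arc_path set \<Rightarrow> ennreal" where
  "modulus M p \<Gamma> = (INF \<rho> \<in> {\<rho>. admissible \<Gamma> \<rho>}. \<integral>\<^sup>+ x. ennreal_powr (\<rho> x) p \<partial>M)"

definition AM_admissible :: "'a::metric_space arc_path set \<Rightarrow> (nat \<Rightarrow> 'a \<Rightarrow> ennreal) \<Rightarrow> bool" where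
  "AM_admissible \<Gamma> \<rho> \<longleftrightarrow>
     (\<forall>i. \<rho> i \<in> borel_measurable borel) \<and>
     (\<forall>\<gamma>\<in>\<Gamma>. 1 \<le> liminf (\<lambda>i. path_integral \<gamma> (\<rho> i)))"

definition AM_modulus :: "'a::metric_space measure \<Rightarrow> 'a arc_path set \<Rightarrow> ennreal" where
  "AM_modulus M \<Gamma> =
     (INF \<rho> \<in> {\<rho>. AM_admissible \<Gamma> \<rho>}. liminf (\<lambda>i. \<integral>\<^sup>+ x. \<rho> i x \<partial>M))"

text \<open>
  Radius \<open>0\<close> is permitted so that finite covers count as sequences of balls: \<open>ball x 0\<close> is empty
  and contributes the term \<open>0 / 0 = 0\<close> (in \<^typ>\<open>ennreal\<close>). The supremum of the radii is
  taken in \<^typ>\<open>ennreal\<close> because it is unspecified in \<^typ>\<open>real\<close> for unbounded sequences.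
\<close>

definition codim_hausdorff_content ::
    "'a::metric_space measure \<Rightarrow> real \<Rightarrow> real \<Rightarrow> 'a set \<Rightarrow> ennreal" where
  "codim_hausdorff_content M p \<delta> E =
     (INF (x, r) \<in> {(x, r). (\<forall>j::nat. 0 \<le> r j) \<and> E \<subseteq> (\<Union>j. ball (x j) (r j)) \<and>
                          (SUP j. ennreal (r j)) < ennreal \<delta>}.
        \<Sum>j. emeasure M (ball (x j) (r j)) / ennreal (r j powr p))"

definition codim_hausdorff :: "'a::metric_space measure \<Rightarrow> real \<Rightarrow> 'a set \<Rightarrow> ennreal" where
  "codim_hausdorff M p E = (SUP \<delta> \<in> {0<..}. codim_hausdorff_content M p \<delta> E)"

end

theory Submission
  imports Defs
begin

text \<open>
  Given a covering of \<open>E\<close> by balls \<open>B(x\<^sub>j, r\<^sub>j)\<close> with \<open>r\<^sub>j < \<delta>\<close>, let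
  \<open>f = (\<Sum>j. r\<^sub>j\<^sup>-\<^sup>p 1\<^bsub>B(x\<^sub>j, 2r\<^sub>j)\<^esub>)\<^sup>1\<^sup>/\<^sup>p\<close>. Doubling bounds
  \<open>\<integral>f\<^sup>p d\<mu>\<close> by \<open>C\<close> times the sum of the covering. A path of length at least \<open>\<delta>\<close> that meets
  \<open>B(x\<^sub>j, r\<^sub>j)\<close> spends length at least \<open>r\<^sub>j\<close> in \<open>B(x\<^sub>j, 2r\<^sub>j)\<close>, where \<open>f \<ge> 1/r\<^sub>j\<close>, so its
  \<open>f\<close>-length is at least \<open>1\<close>. For \<open>p = 1\<close> and \<open>\<delta> \<rightarrow> 0\<close> these functions form an \<open>AM\<close>-admissible
  sequence.

  For \<open>p > 1\<close> the support \<open>U\<close> of \<open>f\<close> has measure of order \<open>\<delta>\<^sup>p\<close>. Starting from \<open>F\<^sub>0 = 0\<close>, put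
  \<open>F\<^sub>n\<^sub>+\<^sub>1 = F\<^sub>n + a\<^sub>n f\<close> with \<open>a\<^sub>n = 1/(n+1)\<close> and \<open>\<delta>\<close> so small that \<open>\<integral>\<^sub>U F\<^sub>n\<^sup>p d\<mu> \<le> a\<^sub>n\<^sup>p\<close>. As
  \<open>F\<^sub>n\<close> changes only on \<open>U\<close>, its \<open>p\<close>-energy grows by a multiple of the summable \<open>a\<^sub>n\<^sup>p\<close>, whereas
  path integrals eventually grow by the non-summable \<open>a\<^sub>n\<close>. Small multiples of the limit show that
  the modulus vanishes.
\<close>

section \<open>Powers of extended nonnegative reals\<close>

lemma ennreal_powr_top [simp]: "ennreal_powr \<infinity> p = \<infinity>"
  by (simp add: ennreal_powr_def)

lemma ennreal_powr_ennreal: "0 \<le> x \<Longrightarrow> ennreal_powr (ennreal x) p = ennreal (x powr p)"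
  by (simp add: ennreal_powr_def)

lemma ennreal_powr_one [simp]: "ennreal_powr x 1 = x"
  by (cases x) (auto simp: ennreal_powr_def)

lemma ennreal_powr_zero [simp]: "ennreal_powr 0 p = 0"
  by (simp add: ennreal_powr_def)

lemma borel_measurable_ennreal_powr [measurable]:
  "(\<lambda>x. ennreal_powr x p) \<in> borel_measurable borel"
  unfolding ennreal_powr_def by measurable

lemma ennreal_powr_mono:
  assumes "0 \<le> p" "x \<le> y"
  shows "ennreal_powr x p \<le> ennreal_powr y p"
  using assms
  by (cases x; cases y) (auto simp: ennreal_powr_ennreal powr_mono2 top_unique
      ennreal_powr_top[unfolded infinity_ennreal_def] intro!: ennreal_leI)

lemma ennreal_powr_powr_inverse:
  assumes "0 < p"
  shows "ennreal_powr (ennreal_powr x p) (1 / p) = x"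
    and "ennreal_powr (ennreal_powr x (1 / p)) p = x"
  using assms
  by (cases x; simp add: ennreal_powr_ennreal powr_powr
      ennreal_powr_top[unfolded infinity_ennreal_def])+

lemma ennreal_powr_cmult:
  assumes "0 < c"
  shows "ennreal_powr (ennreal c * x) p = ennreal (c powr p) * ennreal_powr x p"
  using assms
  by (cases x) (auto simp: ennreal_powr_ennreal powr_mult ennreal_mult_top
      ennreal_powr_top[unfolded infinity_ennreal_def] simp flip: ennreal_mult)

text \<open>Since x + y is at most 2 max(x, y), monotonicity gives the constant 2^p; any finite
  constant serves the energy estimate in \<open>modulus_step\<close>.\<close>

lemma ennreal_powr_add_le:
  assumes "0 \<le> p"
  shows "ennreal_powr (x + y) p \<le> ennreal (2 powr p) * (ennreal_powr x p + ennreal_powr y p)"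
proof -
  have "x + y \<le> ennreal 2 * max x y"
    using add_mono[of x "max x y" y "max x y"] by (simp add: mult_2)
  then have "ennreal_powr (x + y) p \<le> ennreal (2 powr p) * ennreal_powr (max x y) p"
    using ennreal_powr_mono[OF assms] ennreal_powr_cmult[of 2 "max x y" p] by fastforce
  also have "\<dots> \<le> ennreal (2 powr p) * (ennreal_powr x p + ennreal_powr y p)"
    by (intro mult_left_mono) (auto simp: max_def)
  finally show ?thesis .
qed

text \<open>Each \<open>f i\<close> lies below the 1/p-th power of the right-hand supremum, and
  raising to the power p undoes the root. This carries energy bounds to a limit of
  functions.\<close>

lemma ennreal_powr_SUP_le:
  assumes "0 < p"
  shows "ennreal_powr (SUP i\<in>I. f i) p \<le> (SUP i\<in>I. ennreal_powr (f i) p)"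
proof -
  have "(SUP i\<in>I. f i) \<le> ennreal_powr (SUP i\<in>I. ennreal_powr (f i) p) (1 / p)"
  proof (rule SUP_least)
    fix i assume "i \<in> I"
    then show "f i \<le> ennreal_powr (SUP i\<in>I. ennreal_powr (f i) p) (1 / p)"
      using ennreal_powr_mono[of "1 / p", OF _ SUP_upper[of i I "\<lambda>i. ennreal_powr (f i) p"]] assms
      by (simp add: ennreal_powr_powr_inverse)
  qed
  from ennreal_powr_mono[OF less_imp_le[OF assms] this] show ?thesis
    using assms by (simp add: ennreal_powr_powr_inverse)
qed

section \<open>Absolute continuity of the integral\<close>

text \<open>Truncate at a height k that leaves a tail of integral at most e/2; the truncated part
  contributes at most k times the measure of the set.\<close>

lemma nn_integral_absolutely_continuous:
  fixes f :: "'a \<Rightarrow> ennreal"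
  assumes [measurable]: "f \<in> borel_measurable M"
    and fin: "(\<integral>\<^sup>+ x. f x \<partial>M) < \<infinity>" and e: "0 < e"
  obtains \<eta> :: real where "0 < \<eta>"
    "\<And>A. A \<in> sets M \<Longrightarrow> emeasure M A \<le> ennreal \<eta> \<Longrightarrow> (\<integral>\<^sup>+ x\<in>A. f x \<partial>M) \<le> ennreal e"
proof -
  let ?m = "\<lambda>k::nat. \<lambda>x. min (f x) (of_nat k)"
  have "(SUP k. ?m k x) = f x" for x
  proof (rule antisym)
    show "f x \<le> (SUP k. ?m k x)"
    proof (rule ccontr)
      assume "\<not> f x \<le> (SUP k. ?m k x)"
      then have less: "(SUP k. ?m k x) < f x" by simp
      then have "(SUP k. ?m k x) < top" using less_le_trans top_greatest by blast
      then obtain k where k: "(SUP k. ?m k x) < of_nat k"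
        using ennreal_Ex_less_of_nat by (auto simp: less_top)
      have "?m k x \<le> (SUP k. ?m k x)" by (rule SUP_upper) simp
      with k less show False by (auto simp: min_def split: if_splits)
    qed
  qed (auto intro!: SUP_least)
  moreover have "(\<integral>\<^sup>+ x. (SUP k. ?m k x) \<partial>M) = (SUP k. \<integral>\<^sup>+ x. ?m k x \<partial>M)"
  proof (rule nn_integral_monotone_convergence_SUP)
    show "incseq ?m"
      unfolding incseq_def le_fun_def by (intro allI impI min.mono order_refl) simp
  qed simp
  ultimately have SUP: "(\<integral>\<^sup>+ x. f x \<partial>M) = (SUP k. \<integral>\<^sup>+ x. ?m k x \<partial>M)" by simp
  have "\<exists>k. (\<integral>\<^sup>+ x. f x \<partial>M) \<le> (\<integral>\<^sup>+ x. ?m k x \<partial>M) + ennreal (e / 2)"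
  \<comment> \<open>Subtraction in \<open>ennreal\<close> stops at 0, so subtracting e/2 strictly
    lowers the integral only if it is positive.\<close>
  proof (cases "(\<integral>\<^sup>+ x. f x \<partial>M) = 0")
    case False
    then have "(\<integral>\<^sup>+ x. f x \<partial>M) - ennreal (e / 2) < (SUP k. \<integral>\<^sup>+ x. ?m k x \<partial>M)"
      using fin e unfolding SUP[symmetric]
      by (intro ennreal_between) (auto simp: zero_less_iff_neq_zero)
    then obtain k where "(\<integral>\<^sup>+ x. f x \<partial>M) - ennreal (e / 2) < (\<integral>\<^sup>+ x. ?m k x \<partial>M)"
      by (auto simp: less_SUP_iff)
    then show ?thesis
      using fin by (intro exI[of _ k]) (auto dest!: less_imp_le simp: ennreal_minus_le_iff add.commute)
  qed auto
  then obtain k where k: "(\<integral>\<^sup>+ x. f x \<partial>M) \<le> (\<integral>\<^sup>+ x. ?m k x \<partial>M) + ennreal (e / 2)" ..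
  have split: "?m k x + (f x - ?m k x) = f x" for x
    by (simp add: add_diff_inverse_ennreal)
  have "(\<integral>\<^sup>+ x. ?m k x \<partial>M) + (\<integral>\<^sup>+ x. f x - ?m k x \<partial>M) = (\<integral>\<^sup>+ x. f x \<partial>M)"
    by (subst nn_integral_add[symmetric]) (auto simp: split)
  with k have "(\<integral>\<^sup>+ x. ?m k x \<partial>M) + (\<integral>\<^sup>+ x. f x - ?m k x \<partial>M)
      \<le> (\<integral>\<^sup>+ x. ?m k x \<partial>M) + ennreal (e / 2)" by simp
  moreover have "(\<integral>\<^sup>+ x. ?m k x \<partial>M) \<noteq> \<infinity>"
  proof -
    have "(\<integral>\<^sup>+ x. ?m k x \<partial>M) \<le> (\<integral>\<^sup>+ x. f x \<partial>M)" by (rule nn_integral_mono) simp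
    with fin show ?thesis by auto
  qed
  ultimately have tail: "(\<integral>\<^sup>+ x. f x - ?m k x \<partial>M) \<le> ennreal (e / 2)"
    by (simp add: ennreal_add_left_cancel_le)
  \<comment> \<open>The denominator k + 1 covers k = 0 and keeps k * \<eta> at most e/2.\<close>
  define \<eta> where "\<eta> = e / (2 * (real k + 1))"
  show thesis
  proof (rule that)
    show "0 < \<eta>" using e by (simp add: \<eta>_def)
    fix A assume [measurable]: "A \<in> sets M" and A: "emeasure M A \<le> ennreal \<eta>"
    have "(\<integral>\<^sup>+ x\<in>A. f x \<partial>M) \<le> (\<integral>\<^sup>+ x. (f x - ?m k x) + of_nat k * indicator A x \<partial>M)"
    proof (rule nn_integral_mono)
      fix x
      have "f x \<le> of_nat k + (f x - ?m k x)"
        using split[of x] by (metis add_right_mono min.cobounded2)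
      then show "f x * indicator A x \<le> (f x - ?m k x) + of_nat k * indicator A x"
        by (auto simp: add.commute split: split_indicator)
    qed
    also have "\<dots> = (\<integral>\<^sup>+ x. f x - ?m k x \<partial>M) + of_nat k * emeasure M A"
      by (subst nn_integral_add) (auto simp: nn_integral_cmult_indicator)
    also have "\<dots> \<le> ennreal (e / 2) + of_nat k * ennreal \<eta>"
      by (intro add_mono tail mult_left_mono A) auto
    also have "\<dots> = ennreal (e / 2 + real k * \<eta>)"
      using \<open>0 < \<eta>\<close> e
      by (simp add: ennreal_of_nat_eq_real_of_nat flip: ennreal_mult ennreal_plus)
    also have "\<dots> \<le> ennreal e"
    proof (rule ennreal_leI)
      have "real k * \<eta> \<le> (real k + 1) * \<eta>" using \<open>0 < \<eta>\<close> by simp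
      also have "\<dots> = e / 2" by (simp add: \<eta>_def field_simps)
      finally show "e / 2 + real k * \<eta> \<le> e" by simp
    qed
    finally show "(\<integral>\<^sup>+ x\<in>A. f x \<partial>M) \<le> ennreal e" .
  qed
qed

section \<open>Arclength parametrized paths\<close>

text \<open>Appending u as a last node to a partition of [a, s] gives a partition of [a, u] whose
  sum has grown by the last distance.\<close>

lemma curve_length_add_dist_le:
  assumes "a \<le> s" "s \<le> u"
  shows "curve_length \<gamma> a s + ennreal (dist (\<gamma> s) (\<gamma> u)) \<le> curve_length \<gamma> a u"
proof -
  let ?S = "\<lambda>(n, t). \<Sum>i<n. dist (\<gamma> (t i)) (\<gamma> (t (Suc i)))"
  let ?P = "\<lambda>s. {(n, t). t 0 = a \<and> t n = s \<and> mono_on {..n} (t :: nat \<Rightarrow> real)}"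
  \<comment> \<open>The one-step partition shows that the index set is nonempty, as is required for
    moving the constant into the supremum.\<close>
  have "(1, \<lambda>i. if i = 0 then a else s) \<in> ?P s"
    using assms by (auto simp: mono_on_def)
  then have "?P s \<noteq> {}" by blast
  then have "curve_length \<gamma> a s + ennreal (dist (\<gamma> s) (\<gamma> u))
      = (SUP x\<in>?P s. ennreal (?S x) + ennreal (dist (\<gamma> s) (\<gamma> u)))"
    unfolding curve_length_def
    by (subst ennreal_SUP_add_left) (auto simp: case_prod_beta)
  also have "\<dots> \<le> curve_length \<gamma> a u"
  proof (rule SUP_least)
    fix z assume "z \<in> ?P s"
    then obtain n t where z: "z = (n, t)" and t: "a = t 0" "s = t n" "mono_on {..n} t"
      by auto
    let ?t = "t(Suc n := u)"
    have "mono_on {..Suc n} ?t"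
    proof (rule mono_onI)
      fix i j assume "i \<in> {..Suc n}" "j \<in> {..Suc n}" "i \<le> j"
      then show "?t i \<le> ?t j"
        using t(2) assms mono_onD[OF t(3), of i j] mono_onD[OF t(3), of i n]
        by (cases "j = Suc n"; cases "i = Suc n") auto
    qed
    then have "(Suc n, ?t) \<in> ?P u" using t by simp
    then have "ennreal (?S (Suc n, ?t)) \<le> curve_length \<gamma> a u"
      unfolding curve_length_def by (intro SUP_upper2[of "(Suc n, ?t)"]) auto
    moreover have "?S (Suc n, ?t) = ?S (n, t) + dist (\<gamma> s) (\<gamma> u)"
      using t(2) by (auto intro!: sum.cong)
    ultimately show "ennreal (?S z) + ennreal (dist (\<gamma> s) (\<gamma> u)) \<le> curve_length \<gamma> a u"
      by (simp add: z sum_nonneg)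
  qed
  finally show ?thesis .
qed

text \<open>In arclength parametrization the lengths up to s and u are s and u themselves, so the
  preceding lemma makes \<gamma> 1-Lipschitz on [0, l].\<close>

lemma arc_path_dist_le:
  assumes "is_arc_path (l, \<gamma>)" "s \<in> {0..l}" "u \<in> {0..l}"
  shows "dist (\<gamma> s) (\<gamma> u) \<le> \<bar>s - u\<bar>"
proof -
  have *: "dist (\<gamma> s) (\<gamma> u) \<le> u - s" if "s \<in> {0..l}" "u \<in> {0..l}" "s \<le> u" for s u
  proof -
    have "ennreal s + ennreal (dist (\<gamma> s) (\<gamma> u)) \<le> ennreal u"
      using curve_length_add_dist_le[of 0 s u \<gamma>] assms(1) that
      by (simp add: is_arc_path_def)
    then show ?thesis using that by (simp flip: ennreal_plus)
  qed
  show ?thesis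
    using *[of s u] *[of u s] assms by (cases "s \<le> u") (auto simp: dist_commute)
qed

text \<open>As \<gamma> is arbitrary outside \<open>{0..l}\<close>, measurability is first obtained
  on the restricted space; the indicator then carries it to the whole line.\<close>

lemma arc_path_measurable:
  assumes "is_arc_path (l, \<gamma>)" and [measurable]: "f \<in> borel_measurable borel"
  shows "(\<lambda>s. f (\<gamma> s) * indicator {0..l} s :: ennreal) \<in> borel_measurable borel"
proof -
  have "\<gamma> \<in> borel_measurable (restrict_space borel {0..l})"
    using assms(1) by (intro borel_measurable_continuous_on_restrict) (simp add: is_arc_path_def)
  then have "(\<lambda>s. f (\<gamma> s)) \<in> borel_measurable (restrict_space borel {0..l})"
    by measurable
  then show ?thesis
    by (subst (asm) borel_measurable_restrict_space_iff_ennreal) auto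
qed

lemma path_integral_mono:
  "(\<And>x. f x \<le> g x) \<Longrightarrow> path_integral \<Gamma> f \<le> path_integral \<Gamma> g"
  by (cases \<Gamma>) (auto simp: path_integral_def intro!: nn_integral_mono mult_right_mono)

lemma path_integral_add:
  assumes "is_arc_path \<Gamma>" "f \<in> borel_measurable borel" "g \<in> borel_measurable borel"
  shows "path_integral \<Gamma> (\<lambda>x. f x + g x) = path_integral \<Gamma> f + path_integral \<Gamma> g"
  using assms
  by (cases \<Gamma>)
    (simp add: path_integral_def distrib_right nn_integral_add arc_path_measurable)

lemma path_integral_cmult:
  assumes "is_arc_path \<Gamma>" "f \<in> borel_measurable borel"
  shows "path_integral \<Gamma> (\<lambda>x. c * f x) = c * path_integral \<Gamma> f"
  using assms
  by (cases \<Gamma>)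
    (simp add: path_integral_def mult.assoc nn_integral_cmult arc_path_measurable)

text \<open>The path is 1-Lipschitz, so it stays in the doubled ball for parameters within r of s.
  As r \<le> l, these fill a length of at least r in [0, l], even if s is an endpoint, and the bound
  1/r integrates to at least 1.\<close>

lemma path_integral_near_point_ge:
  assumes \<gamma>: "is_arc_path (l, \<gamma>)" and s: "s \<in> {0..l}" "\<gamma> s \<in> ball y r" and r: "0 < r" "r \<le> l"
    and f: "\<And>x. x \<in> ball y (2 * r) \<Longrightarrow> ennreal (1 / r) \<le> f x"
  shows "1 \<le> path_integral (l, \<gamma>) f"
proof -
  let ?I = "{max 0 (s - r)<..<min l (s + r)}"
  have "r \<le> min l (s + r) - max 0 (s - r)" using s r by auto
  then have "ennreal r \<le> emeasure lborel ?I"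
    using r by (subst emeasure_lborel_Ioo) (auto intro: ennreal_leI)
  then have "ennreal (1 / r) * ennreal r \<le> ennreal (1 / r) * emeasure lborel ?I"
    by (rule mult_left_mono) simp
  also have "ennreal (1 / r) * ennreal r = 1"
    using r by (simp flip: ennreal_mult)
  also have "ennreal (1 / r) * emeasure lborel ?I
      = (\<integral>\<^sup>+ t. ennreal (1 / r) * indicator ?I t \<partial>lborel)"
    by (simp add: nn_integral_cmult_indicator)
  also have "\<dots> \<le> (\<integral>\<^sup>+ t\<in>{0..l}. f (\<gamma> t) \<partial>lborel)"
  proof (rule nn_integral_mono)
    fix t
    have "ennreal (1 / r) \<le> f (\<gamma> t)" if "t \<in> ?I"
    proof (rule f)
      have "dist (\<gamma> s) (\<gamma> t) < r"
        using arc_path_dist_le[OF \<gamma> s(1), of t] that s by auto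
      then show "\<gamma> t \<in> ball y (2 * r)"
        using s(2) dist_triangle[of y "\<gamma> t" "\<gamma> s"] by simp
    qed
    then show "ennreal (1 / r) * indicator ?I t \<le> f (\<gamma> t) * indicator {0..l} t"
      by (auto split: split_indicator)
  qed
  finally show ?thesis by (simp add: path_integral_def)
qed

section \<open>Functions adapted to a covering by balls\<close>

lemma ennreal_inverse_powr_mult:
  assumes "0 < r"
  shows "ennreal ((1 / r) powr p) * m = m / ennreal (r powr p)"
proof -
  have "(1 / r) powr p = inverse (r powr p)"
    using assms by (simp add: powr_divide inverse_eq_divide)
  moreover have "ennreal (inverse (r powr p)) = inverse (ennreal (r powr p))"
    using assms by (intro inverse_ennreal[symmetric]) simp
  ultimately show ?thesis
    unfolding divide_ennreal_def by (simp only: mult.commute)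
qed

text \<open>Both assertions of the theorem rest on this function. Taking the 1/p-th power after the
  summation makes the p-energy an exact sum over the balls, however much they overlap, while a
  single summand still gives the lower bound on each doubled ball. The bounds on the support
  \<open>U\<close> serve the case p > 1.\<close>

lemma covering_function:
  fixes M :: "'a::metric_space measure"
  assumes M: "space M = UNIV" "sets borel \<subseteq> sets M" and dbl: "doubling_measure M C"
    and p: "1 \<le> p" and K: "codim_hausdorff_content M p \<delta> E < K"
  obtains f U where "f \<in> borel_measurable borel" "U \<in> sets borel"
    "\<And>x. x \<notin> U \<Longrightarrow> f x = 0"
    "(\<integral>\<^sup>+ x. ennreal_powr (f x) p \<partial>M) \<le> ennreal C * K"
    "emeasure M U \<le> ennreal C * (ennreal (\<delta> powr p) * K)"
    "\<And>l \<gamma>. (l, \<gamma>) \<in> paths_meeting E \<Longrightarrow> \<delta> \<le> l \<Longrightarrow> 1 \<le> path_integral (l, \<gamma>) f"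
proof -
  obtain x r where r0: "\<And>j::nat. 0 \<le> r j" and cover: "E \<subseteq> (\<Union>j. ball (x j) (r j))"
    and rs: "(SUP j. ennreal (r j)) < ennreal \<delta>"
    and sum: "(\<Sum>j. emeasure M (ball (x j) (r j)) / ennreal (r j powr p)) < K"
    using K unfolding codim_hausdorff_content_def by (auto simp: INF_less_iff)
  have rd: "r j < \<delta>" for j
  proof -
    have "ennreal (r j) < ennreal \<delta>"
      by (rule le_less_trans[OF SUP_upper rs]) simp
    then show ?thesis using r0[of j] by (simp add: ennreal_less_iff)
  qed
  let ?B = "\<lambda>j. ball (x j) (2 * r j)"
  let ?c = "\<lambda>j. ennreal ((1 / r j) powr p)"
  let ?q = "\<lambda>j. emeasure M (ball (x j) (r j)) / ennreal (r j powr p)"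
  define g where "g y = (\<Sum>j. ?c j * indicator (?B j) y)" for y
  define f where "f y = ennreal_powr (g y) (1 / p)" for y
  define U where "U = (\<Union>j. ?B j)"
  have gm: "g \<in> borel_measurable borel"
    unfolding g_def[abs_def]
    by (intro borel_measurable_suminf_order borel_measurable_times_ennreal borel_measurable_const
        borel_measurable_indicator) simp
  have fm: "f \<in> borel_measurable borel"
    unfolding f_def[abs_def] by (rule measurable_compose[OF gm borel_measurable_ennreal_powr])
  have sets [measurable]: "ball y t \<in> sets M" for y t using M(2) by auto
  \<comment> \<open>Doubling speaks of positive radii; for radius 0 both balls are empty. The same
    case split recurs below.\<close>
  have m: "emeasure M (?B j) \<le> ennreal C * emeasure M (ball (x j) (r j))" for j
    using dbl r0[of j] unfolding doubling_measure_def
    by (cases "r j = 0") (auto simp: order.strict_iff_order)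
  have c1: "?c j * emeasure M (?B j) \<le> ennreal C * ?q j" for j
  proof (cases "r j = 0")
    case False
    then have "0 < r j" using r0[of j] by simp
    have "?c j * emeasure M (?B j) \<le> ?c j * (ennreal C * emeasure M (ball (x j) (r j)))"
      by (intro mult_left_mono m) simp
    also have "\<dots> = ennreal C * (?c j * emeasure M (ball (x j) (r j)))"
      by (simp add: mult.left_commute)
    finally show ?thesis by (simp add: ennreal_inverse_powr_mult[OF \<open>0 < r j\<close>])
  qed simp
  have c2: "emeasure M (?B j) \<le> ennreal C * (ennreal (\<delta> powr p) * ?q j)" for j
  proof (cases "r j = 0")
    case False
    then have "0 < r j" using r0[of j] by simp
    \<comment> \<open>Here \<open>r j < \<delta>\<close> enters: the measure of a ball is at most
      \<delta>^p times its term in the content, which makes \<open>U\<close> small.\<close>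
    have "1 = ennreal (r j powr p) * ?c j"
      using \<open>0 < r j\<close> by (simp add: powr_divide flip: ennreal_mult)
    also have "\<dots> \<le> ennreal (\<delta> powr p) * ?c j"
      using rd[of j] \<open>0 < r j\<close> p by (intro mult_right_mono ennreal_leI powr_mono2) auto
    finally have "1 * emeasure M (ball (x j) (r j))
        \<le> ennreal (\<delta> powr p) * ?c j * emeasure M (ball (x j) (r j))"
      by (rule mult_right_mono) simp
    then have "emeasure M (ball (x j) (r j)) \<le> ennreal (\<delta> powr p) * ?q j"
      by (simp add: ennreal_inverse_powr_mult[OF \<open>0 < r j\<close>] mult.assoc)
    then show ?thesis
      using m[of j] by (meson mult_left_mono order_trans zero_le)
  qed simp
  show thesis
  proof (rule that[of f U])
    show "f \<in> borel_measurable borel" by (rule fm)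
    show "U \<in> sets borel" unfolding U_def by auto
    show "f y = 0" if "y \<notin> U" for y
      using that by (simp add: f_def g_def U_def)
    have "(\<integral>\<^sup>+ y. ennreal_powr (f y) p \<partial>M) = (\<integral>\<^sup>+ y. g y \<partial>M)"
      using p by (simp add: f_def ennreal_powr_powr_inverse)
    also have "\<dots> = (\<Sum>j. ?c j * emeasure M (?B j))"
      unfolding g_def by (subst nn_integral_suminf) (auto simp: nn_integral_cmult_indicator)
    also have "\<dots> \<le> (\<Sum>j. ennreal C * ?q j)"
      by (intro suminf_le c1) auto
    also have "\<dots> \<le> ennreal C * K"
      using sum by (auto intro!: mult_left_mono)
    finally show "(\<integral>\<^sup>+ y. ennreal_powr (f y) p \<partial>M) \<le> ennreal C * K" .
    have "emeasure M U \<le> (\<Sum>j. emeasure M (?B j))"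
      unfolding U_def by (rule emeasure_subadditive_countably) auto
    also have "\<dots> \<le> (\<Sum>j. ennreal C * (ennreal (\<delta> powr p) * ?q j))"
      by (intro suminf_le c2) auto
    also have "\<dots> \<le> ennreal C * (ennreal (\<delta> powr p) * K)"
      using sum by (auto intro!: mult_left_mono)
    finally show "emeasure M U \<le> ennreal C * (ennreal (\<delta> powr p) * K)" .
  next
    fix l \<gamma> assume "(l, \<gamma>) \<in> paths_meeting E" and l: "\<delta> \<le> l"
    then obtain s where \<gamma>: "is_arc_path (l, \<gamma>)" and s: "s \<in> {0..l}" "\<gamma> s \<in> E"
      by (fastforce simp: paths_meeting_def)
    then obtain j where j: "\<gamma> s \<in> ball (x j) (r j)" using cover by auto
    then have rj: "0 < r j" using le_less_trans[OF zero_le_dist, of "x j" "\<gamma> s" "r j"] by simp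
    show "1 \<le> path_integral (l, \<gamma>) f"
    proof (rule path_integral_near_point_ge[OF \<gamma> s(1) j rj])
      show "r j \<le> l" using rd[of j] l by simp
      fix y assume "y \<in> ?B j"
      then have "?c j \<le> g y"
        unfolding g_def
        using sum_le_suminf[of "\<lambda>j. ?c j * indicator (?B j) y" "{j}"] by simp
      then have "ennreal_powr (?c j) (1 / p) \<le> f y"
        unfolding f_def using p by (intro ennreal_powr_mono) auto
      then show "ennreal (1 / r j) \<le> f y"
        using p rj by (simp add: ennreal_powr_ennreal powr_powr)
    qed
  qed
qed

section \<open>The bound for the AM-modulus by the Hausdorff measure of codimension 1\<close>

lemma codim_hausdorff_content_le:
  "0 < \<delta> \<Longrightarrow> codim_hausdorff_content M p \<delta> E \<le> codim_hausdorff M p E"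
  unfolding codim_hausdorff_def by (rule SUP_upper) simp

lemma AM_modulus_le_codim_hausdorff:
  fixes M :: "'a::metric_space measure"
  assumes M: "space M = UNIV" "sets borel \<subseteq> sets M" and dbl: "doubling_measure M C"
  shows "AM_modulus M (paths_meeting E) \<le> ennreal C * codim_hausdorff M 1 E"
proof (cases "codim_hausdorff M 1 E < \<infinity>")
  case False
  \<comment> \<open>The right-hand side is infinite once \<open>ennreal C\<close> is nonzero, which
    doubling forces at radius 1 because balls have positive measure.\<close>
  have "0 < emeasure M (ball undefined (2 * 1))"
    "emeasure M (ball undefined (2 * 1)) \<le> ennreal C * emeasure M (ball undefined 1)"
    using dbl unfolding doubling_measure_def by (metis mult_pos_pos zero_less_numeral zero_less_one)+
  then have "ennreal C \<noteq> 0" by auto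
  with False show ?thesis by (simp add: less_top[symmetric])
next
  case True
  let ?H = "codim_hausdorff M 1 E"
  let ?d = "\<lambda>i. 1 / (real i + 1)"
  have "\<exists>f. f \<in> borel_measurable borel
      \<and> (\<integral>\<^sup>+ x. ennreal_powr (f x) 1 \<partial>M) \<le> ennreal C * (?H + ennreal (?d i))
      \<and> (\<forall>l \<gamma>. (l, \<gamma>) \<in> paths_meeting E \<longrightarrow> ?d i \<le> l \<longrightarrow> 1 \<le> path_integral (l, \<gamma>) f)" for i
  proof -
    have "codim_hausdorff_content M 1 (?d i) E \<le> ?H"
      by (rule codim_hausdorff_content_le) simp
    \<comment> \<open>Finiteness of \<open>?H\<close> makes this strict, as
      \<open>covering_function\<close> demands; the excess \<open>?d i\<close> vanishes in the
      limit.\<close>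
    also have "\<dots> < ?H + ennreal (?d i)"
      using True ennreal_add_left_cancel_less[of ?H 0 "ennreal (?d i)"] by simp
    finally show ?thesis
      using covering_function[OF M dbl, of 1] by (metis order_refl)
  qed
  then obtain f where [measurable]: "\<And>i. f i \<in> borel_measurable borel"
    and int: "\<And>i. (\<integral>\<^sup>+ x. ennreal_powr (f i x) 1 \<partial>M) \<le> ennreal C * (?H + ennreal (?d i))"
    and path: "\<And>i l \<gamma>. (l, \<gamma>) \<in> paths_meeting E \<Longrightarrow> ?d i \<le> l \<Longrightarrow> 1 \<le> path_integral (l, \<gamma>) (f i)"
    by metis
  have d0: "?d \<longlonglongrightarrow> 0"
    using LIMSEQ_inverse_real_of_nat by (simp add: inverse_eq_divide add.commute)
  have "AM_admissible (paths_meeting E) f"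
    unfolding AM_admissible_def
  proof safe
    fix l \<gamma> assume \<gamma>: "(l, \<gamma>) \<in> paths_meeting E"
    then have "0 < l" by (simp add: paths_meeting_def is_arc_path_def)
    \<comment> \<open>The i-th function is good for paths of length at least \<open>?d i\<close>. As
      l is positive, a given path misses only finitely many of them, which the liminf
      ignores.\<close>
    then have "eventually (\<lambda>i. ?d i < l) sequentially"
      using order_tendstoD(2)[OF d0] by simp
    then have "eventually (\<lambda>i. 1 \<le> path_integral (l, \<gamma>) (f i)) sequentially"
      by eventually_elim (simp add: path[OF \<gamma>])
    then show "1 \<le> liminf (\<lambda>i. path_integral (l, \<gamma>) (f i))"
      by (rule Liminf_bounded)
  qed measurable
  then have "AM_modulus M (paths_meeting E) \<le> liminf (\<lambda>i. \<integral>\<^sup>+ x. f i x \<partial>M)"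
    unfolding AM_modulus_def by (intro INF_lower) simp
  also have "\<dots> \<le> liminf (\<lambda>i. ennreal C * (?H + ennreal (?d i)))"
    using int by (intro Liminf_mono always_eventually allI) simp
  also have "\<dots> = ennreal C * ?H"
  proof (rule lim_imp_Liminf)
    have "(\<lambda>i. ennreal C * (?H + ennreal (?d i))) \<longlonglongrightarrow> ennreal C * (?H + ennreal 0)"
      using d0 by (intro ennreal_tendsto_cmult tendsto_add tendsto_const tendsto_ennrealI) auto
    then show "(\<lambda>i. ennreal C * (?H + ennreal (?d i))) \<longlonglongrightarrow> ennreal C * ?H" by simp
  qed simp
  finally show ?thesis .
qed

section \<open>Paths of zero modulus\<close>

text \<open>The gain along paths is linear in a, while the cost in energy is of order a^p. The
  factor 2^p must not multiply the full energy of \<open>F\<close>, since it would compound under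
  iteration; it multiplies only the energy on the support of the new function, which absolute
  continuity makes at most a^p.\<close>

lemma modulus_step:
  fixes M :: "'a::metric_space measure"
  assumes M: "space M = UNIV" "sets borel \<subseteq> sets M" and dbl: "doubling_measure M C"
    and p: "1 < p" and K: "codim_hausdorff M p E < K" "K < \<infinity>" and a: "0 < a"
    and F: "F \<in> borel_measurable borel" "(\<integral>\<^sup>+ x. ennreal_powr (F x) p \<partial>M) < \<infinity>"
  obtains G where "G \<in> borel_measurable borel" "F \<le> G"
    "(\<integral>\<^sup>+ x. ennreal_powr (G x) p \<partial>M)
      \<le> (\<integral>\<^sup>+ x. ennreal_powr (F x) p \<partial>M) + ennreal (2 powr p) * (1 + ennreal C * K) * ennreal (a powr p)"
    "\<And>l \<gamma>. (l, \<gamma>) \<in> paths_meeting E \<Longrightarrow> a \<le> l \<Longrightarrow>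
      path_integral (l, \<gamma>) F + ennreal a \<le> path_integral (l, \<gamma>) G"
proof -
  have bm: "g \<in> borel_measurable M" if "g \<in> borel_measurable borel" for g :: "'a \<Rightarrow> ennreal"
    using that M by (auto simp: measurable_def)
  have [measurable]: "F \<in> borel_measurable M" by (rule bm[OF F(1)])
  have ap: "0 < a powr p" using a by simp
  have "(\<lambda>x. ennreal_powr (F x) p) \<in> borel_measurable M" by measurable
  from nn_integral_absolutely_continuous[OF this F(2) ap]
  obtain \<eta> where \<eta>: "0 < \<eta>" "\<And>A. A \<in> sets M \<Longrightarrow> emeasure M A \<le> ennreal \<eta> \<Longrightarrow>
      (\<integral>\<^sup>+ x\<in>A. ennreal_powr (F x) p \<partial>M) \<le> ennreal (a powr p)"
    by blast
  obtain c where c: "ennreal C * K = ennreal c" "0 \<le> c"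
    using K(2) by (cases "ennreal C * K") (auto simp: ennreal_mult_eq_top_iff)
  \<comment> \<open>The first entry lets the covering function serve all paths of length at least a;
    the second gives \<delta>^p c \<le> \<eta>, with c + 1 to avoid dividing by 0.\<close>
  define \<delta> where "\<delta> = min a ((\<eta> / (c + 1)) powr (1 / p))"
  have \<delta>: "0 < \<delta>" "\<delta> \<le> a" using a \<eta>(1) c(2) by (auto simp: \<delta>_def)
  have "\<delta> powr p \<le> ((\<eta> / (c + 1)) powr (1 / p)) powr p"
    using \<delta>(1) p by (intro powr_mono2) (auto simp: \<delta>_def)
  also have "\<dots> = \<eta> / (c + 1)" using p \<eta>(1) c(2) by (simp add: powr_powr)
  finally have "\<delta> powr p * c \<le> \<eta> / (c + 1) * c" using c(2) by (rule mult_right_mono)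
  also have "\<dots> \<le> \<eta>" using \<eta>(1) c(2) by (simp add: field_simps)
  finally have \<delta>\<eta>: "\<delta> powr p * c \<le> \<eta>" .
  have "codim_hausdorff_content M p \<delta> E < K"
    using codim_hausdorff_content_le[OF \<delta>(1)] K(1) by (rule le_less_trans)
  from covering_function[OF M dbl less_imp_le[OF p] this]
  obtain f U where f: "f \<in> borel_measurable borel" and U: "U \<in> sets borel"
    and f0: "\<And>x. x \<notin> U \<Longrightarrow> f x = 0"
    and int: "(\<integral>\<^sup>+ x. ennreal_powr (f x) p \<partial>M) \<le> ennreal C * K"
    and mU: "emeasure M U \<le> ennreal C * (ennreal (\<delta> powr p) * K)"
    and path: "\<And>l \<gamma>. (l, \<gamma>) \<in> paths_meeting E \<Longrightarrow> \<delta> \<le> l \<Longrightarrow> 1 \<le> path_integral (l, \<gamma>) f"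
    by blast
  have [measurable]: "f \<in> borel_measurable M" "U \<in> sets M" using bm[OF f] U M(2) by auto
  have "emeasure M U \<le> ennreal (\<delta> powr p) * ennreal c"
    using mU unfolding c(1)[symmetric] by (simp only: mult.left_commute)
  also have "\<dots> \<le> ennreal \<eta>"
    using \<delta>\<eta> by (simp add: ennreal_leI flip: ennreal_mult')
  finally have FU: "(\<integral>\<^sup>+ x\<in>U. ennreal_powr (F x) p \<partial>M) \<le> ennreal (a powr p)"
    by (intro \<eta>(2)) measurable
  show thesis
  proof (rule that[of "\<lambda>x. F x + ennreal a * f x"])
    show "(\<lambda>x. F x + ennreal a * f x) \<in> borel_measurable borel"
      using F(1) f by measurable
    show "F \<le> (\<lambda>x. F x + ennreal a * f x)" by (simp add: le_fun_def)
    \<comment> \<open>Outside \<open>U\<close> the function f vanishes and the first term is the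
      exact value; inside \<open>U\<close> the remaining terms already dominate.\<close>
    have "ennreal_powr (F x + ennreal a * f x) p
        \<le> ennreal_powr (F x) p + ennreal (2 powr p) *
          (ennreal_powr (F x) p * indicator U x + ennreal (a powr p) * ennreal_powr (f x) p)" for x
    proof (cases "x \<in> U")
      case True
      have "ennreal_powr (F x + ennreal a * f x) p
          \<le> ennreal (2 powr p) * (ennreal_powr (F x) p + ennreal_powr (ennreal a * f x) p)"
        using p by (intro ennreal_powr_add_le) simp
      also have "\<dots> \<le> ennreal_powr (F x) p + \<dots>"
        by simp
      finally show ?thesis using True a by (simp add: ennreal_powr_cmult)
    qed (simp add: f0)
    then have "(\<integral>\<^sup>+ x. ennreal_powr (F x + ennreal a * f x) p \<partial>M)
        \<le> (\<integral>\<^sup>+ x. ennreal_powr (F x) p + ennreal (2 powr p) *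
          (ennreal_powr (F x) p * indicator U x + ennreal (a powr p) * ennreal_powr (f x) p) \<partial>M)"
      by (intro nn_integral_mono)
    also have "\<dots> = (\<integral>\<^sup>+ x. ennreal_powr (F x) p \<partial>M) + ennreal (2 powr p) *
          ((\<integral>\<^sup>+ x\<in>U. ennreal_powr (F x) p \<partial>M)
            + ennreal (a powr p) * (\<integral>\<^sup>+ x. ennreal_powr (f x) p \<partial>M))"
      by (simp add: nn_integral_add nn_integral_cmult)
    also have "\<dots> \<le> (\<integral>\<^sup>+ x. ennreal_powr (F x) p \<partial>M) + ennreal (2 powr p) *
          (ennreal (a powr p) + ennreal (a powr p) * (ennreal C * K))"
      by (intro add_mono mult_left_mono order_refl FU int) auto
    also have "\<dots> = (\<integral>\<^sup>+ x. ennreal_powr (F x) p \<partial>M)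
        + ennreal (2 powr p) * (1 + ennreal C * K) * ennreal (a powr p)"
      by (simp add: algebra_simps)
    finally show "(\<integral>\<^sup>+ x. ennreal_powr (F x + ennreal a * f x) p \<partial>M) \<le> \<dots>" .
  next
    fix l \<gamma> assume \<gamma>: "(l, \<gamma>) \<in> paths_meeting E" and "a \<le> l"
    then have "1 \<le> path_integral (l, \<gamma>) f" using \<delta>(2) by (intro path) auto
    then have "ennreal a * 1 \<le> ennreal a * path_integral (l, \<gamma>) f" by (rule mult_left_mono) simp
    moreover have "is_arc_path (l, \<gamma>)" using \<gamma> by (simp add: paths_meeting_def)
    ultimately show "path_integral (l, \<gamma>) F + ennreal a
        \<le> path_integral (l, \<gamma>) (\<lambda>x. F x + ennreal a * f x)"
      using F(1) f by (simp add: path_integral_add path_integral_cmult add_left_mono)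
  qed
qed

text \<open>Infinite path integrals survive scaling, so t \<rho> is admissible for every t > 0, and
  its energy is t^p times a finite number.\<close>

lemma modulus_eq_0I:
  assumes \<rho>: "\<rho> \<in> borel_measurable borel" and M: "space M = UNIV" "sets borel \<subseteq> sets M"
    and p: "0 < p" and fin: "(\<integral>\<^sup>+ x. ennreal_powr (\<rho> x) p \<partial>M) < \<infinity>"
    and arc: "\<And>\<gamma>. \<gamma> \<in> \<Gamma> \<Longrightarrow> is_arc_path \<gamma>"
    and inf: "\<And>\<gamma>. \<gamma> \<in> \<Gamma> \<Longrightarrow> path_integral \<gamma> \<rho> = \<infinity>"
  shows "modulus M p \<Gamma> = 0"
proof -
  have [measurable]: "\<rho> \<in> borel_measurable M"
    using \<rho> M by (auto simp: measurable_def)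
  obtain j where j: "(\<integral>\<^sup>+ x. ennreal_powr (\<rho> x) p \<partial>M) = ennreal j" "0 \<le> j"
    using fin by (cases "\<integral>\<^sup>+ x. ennreal_powr (\<rho> x) p \<partial>M") auto
  have "modulus M p \<Gamma> \<le> 0 + ennreal e" if "0 < e" for e
  proof -
    define t where "t = (e / (j + 1)) powr (1 / p)"
    have t: "0 < t" "t powr p = e / (j + 1)"
      using that j(2) p by (auto simp: t_def powr_powr)
    have "admissible \<Gamma> (\<lambda>x. ennreal t * \<rho> x)"
      unfolding admissible_def using \<rho> arc inf t(1)
      by (auto simp: path_integral_cmult ennreal_mult_top)
    then have "modulus M p \<Gamma> \<le> (\<integral>\<^sup>+ x. ennreal_powr (ennreal t * \<rho> x) p \<partial>M)"
      unfolding modulus_def by (intro INF_lower) simp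
    also have "\<dots> = ennreal (t powr p) * ennreal j"
      using t(1) by (simp add: ennreal_powr_cmult nn_integral_cmult j(1))
    also have "\<dots> \<le> ennreal e"
      using that j(2) by (simp add: t(2) field_simps ennreal_leI flip: ennreal_mult')
    finally show ?thesis by simp
  qed
  then have "modulus M p \<Gamma> \<le> 0" by (rule ennreal_le_epsilon)
  then show ?thesis by simp
qed

lemma modulus_paths_meeting_eq_0:
  fixes M :: "'a::metric_space measure"
  assumes M: "space M = UNIV" "sets borel \<subseteq> sets M" and dbl: "doubling_measure M C"
    and p: "1 < p" and fin: "codim_hausdorff M p E < \<infinity>"
  shows "modulus M p (paths_meeting E) = 0"
proof -
  have bm: "g \<in> borel_measurable M" if "g \<in> borel_measurable borel" for g :: "'a \<Rightarrow> ennreal"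
    using that M by (auto simp: measurable_def)
  \<comment> \<open>The same \<open>K\<close> serves every step, so the constant \<open>L\<close>
    does not depend on n.\<close>
  obtain K where K: "codim_hausdorff M p E < K" "K < \<infinity>"
    using dense[OF fin] by blast
  define L where "L = ennreal (2 powr p) * (1 + ennreal C * K)"
  have L: "L < \<infinity>" using K(2) by (simp add: L_def ennreal_mult_less_top)
  define a where "a n = 1 / (real n + 1)" for n
  let ?I = "\<lambda>F. \<integral>\<^sup>+ x. ennreal_powr (F x) p \<partial>M"
  \<comment> \<open>Finite energy is part of the invariant because the next step needs it for
    absolute continuity; the last conjunct fixes the start at 0.\<close>
  let ?P = "\<lambda>(n::nat) F. F \<in> borel_measurable borel \<and> ?I F < \<infinity> \<and> (n = 0 \<longrightarrow> F = (\<lambda>_. 0))"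
  let ?Q = "\<lambda>(n::nat) F G. F \<le> G \<and> ?I G \<le> ?I F + L * ennreal (a n powr p) \<and>
    (\<forall>l \<gamma>. (l, \<gamma>) \<in> paths_meeting E \<longrightarrow> a n \<le> l \<longrightarrow>
      path_integral (l, \<gamma>) F + ennreal (a n) \<le> path_integral (l, \<gamma>) G)"
  have "\<exists>F. \<forall>n::nat. ?P n (F n) \<and> ?Q n (F n) (F (Suc n))"
  proof (rule dependent_nat_choice)
    show "\<exists>F. ?P 0 F" by auto
    fix F :: "'a \<Rightarrow> ennreal" and n
    assume "?P n F"
    then have F: "F \<in> borel_measurable borel" "?I F < \<infinity>" by auto
    have "0 < a n" by (simp add: a_def)
    obtain G where G: "G \<in> borel_measurable borel" "F \<le> G"
      "?I G \<le> ?I F + L * ennreal (a n powr p)"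
      "\<And>l \<gamma>. (l, \<gamma>) \<in> paths_meeting E \<Longrightarrow> a n \<le> l \<Longrightarrow>
        path_integral (l, \<gamma>) F + ennreal (a n) \<le> path_integral (l, \<gamma>) G"
      using modulus_step[OF M dbl p K \<open>0 < a n\<close> F] unfolding L_def by blast
    have "?I F + L * ennreal (a n powr p) < \<infinity>"
      using F L by (simp add: ennreal_mult_less_top)
    with G(3) have "?I G < \<infinity>" by (rule le_less_trans)
    with G have "?P (Suc n) G \<and> ?Q n F G" by blast
    then show "\<exists>G. ?P (Suc n) G \<and> ?Q n F G" by (rule exI[of _ G])
  qed
  then obtain F where F: "\<And>n. F n \<in> borel_measurable borel" "F 0 = (\<lambda>_. 0)"
    and mono: "\<And>n. F n \<le> F (Suc n)"
    and int: "\<And>n. ?I (F (Suc n)) \<le> ?I (F n) + L * ennreal (a n powr p)"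
    and path: "\<And>n l \<gamma>. (l, \<gamma>) \<in> paths_meeting E \<Longrightarrow> a n \<le> l \<Longrightarrow>
      path_integral (l, \<gamma>) (F n) + ennreal (a n) \<le> path_integral (l, \<gamma>) (F (Suc n))"
    by blast
  define S where "S x = (SUP n. F n x)" for x
  have "summable (\<lambda>n. real (Suc n) powr - p)"
    using p by (subst summable_Suc_iff) (simp add: summable_real_powr_iff)
  then have "summable (\<lambda>n. a n powr p)"
    by (simp add: a_def powr_divide powr_minus inverse_eq_divide add.commute)
  then have "(\<Sum>n. ennreal (a n powr p)) \<noteq> top"
    by (rule ennreal_suminf_neq_top) simp
  then have J: "L * (\<Sum>n. ennreal (a n powr p)) < \<infinity>"
    using L unfolding infinity_ennreal_def ennreal_mult_less_top less_top by blast
  have "?I (F n) \<le> (\<Sum>i<n. L * ennreal (a i powr p))" for n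
  proof (induction n)
    case (Suc n)
    have "?I (F (Suc n)) \<le> ?I (F n) + L * ennreal (a n powr p)" by (rule int)
    also have "\<dots> \<le> (\<Sum>i<Suc n. L * ennreal (a i powr p))"
      using Suc.IH by (simp add: add_right_mono)
    finally show ?case .
  qed (simp add: F)
  then have IF: "?I (F n) \<le> L * (\<Sum>n. ennreal (a n powr p))" for n
    unfolding ennreal_suminf_cmult[symmetric]
    by (rule order_trans[OF _ sum_le_suminf]) auto
  have "incseq F" by (rule incseq_SucI) (rule mono)
  then have "incseq (\<lambda>n x. ennreal_powr (F n x) p)"
    using p by (auto simp: incseq_def le_fun_def intro!: ennreal_powr_mono)
  then have "(\<integral>\<^sup>+ x. (SUP n. ennreal_powr (F n x) p) \<partial>M) = (SUP n. ?I (F n))"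
    by (rule nn_integral_monotone_convergence_SUP)
      (rule measurable_compose[OF bm[OF F(1)] borel_measurable_ennreal_powr])
  moreover have "?I S \<le> (\<integral>\<^sup>+ x. (SUP n. ennreal_powr (F n x) p) \<partial>M)"
    unfolding S_def using p by (intro nn_integral_mono ennreal_powr_SUP_le) simp
  moreover have "(SUP n. ?I (F n)) \<le> L * (\<Sum>n. ennreal (a n powr p))"
    by (rule SUP_least) (rule IF)
  ultimately have IS: "?I S < \<infinity>" using J by simp
  have Sm: "S \<in> borel_measurable borel"
    unfolding S_def[abs_def] using F(1) by (intro borel_measurable_SUP) auto
  have "path_integral (l, \<gamma>) S = top" if \<gamma>: "(l, \<gamma>) \<in> paths_meeting E" for l \<gamma>
  proof (rule ccontr)
    assume top: "path_integral (l, \<gamma>) S \<noteq> top"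
    have "0 < l" using \<gamma> by (simp add: paths_meeting_def is_arc_path_def)
    \<comment> \<open>A step guarantees its gain on this path once \<open>a n \<le> l\<close>. As
      \<open>a\<close> decreases, all steps from \<open>N\<close> on count, hence the shift by
      \<open>N\<close> in the partial sums.\<close>
    then obtain N where "a N \<le> l"
      unfolding a_def by (metis nat_approx_posE less_imp_le of_nat_Suc add.commute)
    moreover have "a (N + k) \<le> a N" for k by (simp add: a_def frac_le)
    ultimately have al: "a (k + N) \<le> l" for k by (metis add.commute order_trans)
    have "(\<Sum>i<k. ennreal (a (i + N))) \<le> path_integral (l, \<gamma>) (F (k + N))" for k
    proof (induction k)
      case (Suc k)
      have "(\<Sum>i<Suc k. ennreal (a (i + N)))
          \<le> path_integral (l, \<gamma>) (F (k + N)) + ennreal (a (k + N))"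
        using Suc.IH by (simp add: add_right_mono)
      also have "\<dots> \<le> path_integral (l, \<gamma>) (F (Suc k + N))"
        using path[OF \<gamma> al] by simp
      finally show ?case .
    qed simp
    moreover have "path_integral (l, \<gamma>) (F k) \<le> path_integral (l, \<gamma>) S" for k
      by (rule path_integral_mono) (auto simp: S_def intro: SUP_upper)
    ultimately have partial: "(\<Sum>i<k. ennreal (a (i + N))) \<le> path_integral (l, \<gamma>) S" for k
      by (rule order_trans)
    have "(\<Sum>i. ennreal (a (i + N))) \<le> path_integral (l, \<gamma>) S"
      by (rule suminf_le_const[OF summableI partial])
    \<comment> \<open>A finite path integral would bound a tail of the harmonic series.\<close>
    with top have "(\<Sum>i. ennreal (a (i + N))) \<noteq> top" by (auto simp: top_unique)
    then have "summable (\<lambda>i. a (i + N))"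
      by (intro summable_suminf_not_top) (auto simp: a_def)
    then have "summable a" by (simp add: summable_iff_shift)
    then have "summable (\<lambda>n. inverse (of_nat (Suc n)) :: real)"
      by (simp add: a_def[abs_def] inverse_eq_divide add.commute)
    then show False
      using not_summable_harmonic[where 'a = real] by (subst (asm) summable_Suc_iff) blast
  qed
  then have "path_integral \<gamma> S = \<infinity>" if "\<gamma> \<in> paths_meeting E" for \<gamma>
    using that by (cases \<gamma>) simp
  moreover have "is_arc_path \<gamma>" if "\<gamma> \<in> paths_meeting E" for \<gamma>
    using that by (auto simp: paths_meeting_def)
  moreover have "0 < p" using p by simp
  ultimately show ?thesis using modulus_eq_0I[OF Sm M _ IS] by blast
qed

theorem theorem2p1:
  fixes M :: "'a::metric_space measure" and C :: real and E :: "'a set"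
  assumes "borel_regular M"
    and "doubling_measure M C"
  shows "AM_modulus M (paths_meeting E) \<le> ennreal C * codim_hausdorff M 1 E \<and>
         (\<forall>p>1. codim_hausdorff M p E < \<infinity> \<longrightarrow> modulus M p (paths_meeting E) = 0)"
proof -
  have M: "space M = UNIV" "sets borel \<subseteq> sets M"
    using assms(1) by (simp_all add: borel_regular_def)
  show ?thesis
  proof (intro conjI allI impI)
    show "AM_modulus M (paths_meeting E) \<le> ennreal C * codim_hausdorff M 1 E"
      using M assms(2) by (rule AM_modulus_le_codim_hausdorff)
    fix p :: real assume "1 < p" "codim_hausdorff M p E < \<infinity>"
    then show "modulus M p (paths_meeting E) = 0"
      by (rule modulus_paths_meeting_eq_0[OF M assms(2)])
  qed
qed

end
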